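(* Let $x$ be a variable (or a complex number). For all integers $m\geq 0$ we have $H_{2m}\big(kE_{k-1}(x)\big)=H_{2m}\big(kE_{k-1}\big)=0$, and $$H_{2m+1}\big(kE_{k-1}(x)\big)=(-1)^{m+1}\prod_{\ell=1}^m\ell!^{8},$$ $$H_{2m+1}\big(kE_{k-1}\big)=(-1)^{m+1}2^{4m(m+1)}\prod_{\ell=1}^m\ell!^{8}.$$
   Context: The Euler numbers $E_k$ and Euler polynomials $E_k(x)$ are defined by $\frac{2}{e^t+e^{-t}}=\sum_{k\ge 0}E_k\frac{t^k}{k!}$ and $\frac{2e^{xt}}{e^t+1}=\sum_{k\ge 0}E_k(x)\frac{t^k}{k!}$. For a sequence $(c_0,c_1,\ldots)$ (always indexed from $k=0$), $H_n(c_k)=\det\big(c_{i+j}\big)_{0\le i,j\le n}$. The $k=0$ terms of the sequences $(kE_{k-1}(x))_{k\ge 0}$ and $(kE_{k-1})_{k\ge0}$ are defined to be $0$. Here $\ell!^8=(\ell!)^8$, and empty products equal $1$. *)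

theory Defs
  imports "HOL-Computational_Algebra.Computational_Algebra" "Jordan_Normal_Form.Determinant"
begin

definition hankel_det :: "nat \<Rightarrow> (nat \<Rightarrow> 'a :: comm_ring_1) \<Rightarrow> 'a" where
  "hankel_det n c = Determinant.det (mat (n + 1) (n + 1) (\<lambda>(i, j). c (i + j)))"

definition euler_num :: "nat \<Rightarrow> 'a :: field_char_0" where
  "euler_num k = fact k * fps_nth (2 / (fps_exp 1 + fps_exp (-1))) k"

text \<open>
  The series \<open>2 / (e\<^sup>t + 1)\<close> is formed over the field of scalars, where division of power series
  is available, and then regarded as a series in \<open>t\<close> with constant polynomials in \<open>x\<close> as
  coefficients; the other factor is \<open>e\<^bsup>xt\<^esup>\<close>. The generating function is recovered both for a
  formal variable \<open>x\<close> (\<open>euler_poly_gen_fun\<close>) and for a scalar \<open>x\<close> (\<open>poly_euler_poly_gen_fun\<close>).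
\<close>

definition euler_poly :: "nat \<Rightarrow> 'a :: field_char_0 poly" where
  "euler_poly k = fact k *
     fps_nth (Abs_fps (\<lambda>n. [:fps_nth (2 / (fps_exp 1 + 1)) n:]) *
              Abs_fps (\<lambda>n. monom (1 / fact n) n)) k"

lemma fact_times_const_poly: "fact k * [:1 / fact k:] = (1 :: 'a :: field_char_0 poly)"
proof -
  have "(fact k :: 'a poly) = [:fact k:]"
    by (metis of_nat_fact of_nat_poly)
  then show ?thesis by simp
qed

lemma two_div_fps_exp_plus_1:
  "(fps_exp 1 + 1) * (2 / (fps_exp 1 + 1)) = (2 :: 'a :: field_char_0 fps)"
proof -
  have nz: "fps_nth (fps_exp 1 + 1 :: 'a fps) 0 \<noteq> 0" by simp
  show ?thesis
    unfolding fps_divide_unit[OF nz] mult.left_commute[of _ 2] inverse_mult_eq_1'[OF nz] by simp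
qed

lemma euler_poly_gen_fun:
  "(Abs_fps (\<lambda>n. [:1 / fact n:]) + 1) * Abs_fps (\<lambda>k. [:1 / fact k:] * euler_poly k)
     = 2 * Abs_fps (\<lambda>n. monom (1 / fact n) n :: 'a :: field_char_0 poly)"
proof -
  let ?C = "\<lambda>F :: 'a fps. Abs_fps (\<lambda>n. [:fps_nth F n:])"
  let ?X = "Abs_fps (\<lambda>n. monom (1 / fact n) n :: 'a poly)"
  have C_mult: "?C F * ?C G = ?C (F * G)" for F G
  proof (rule fps_ext)
    have const_sum: "(\<Sum>i\<in>A. [:f i:]) = [:sum f A:]" for f :: "nat \<Rightarrow> 'a" and A
      by (induction A rule: infinite_finite_induct) simp_all
    show "fps_nth (?C F * ?C G) n = fps_nth (?C (F * G)) n" for n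
      by (simp add: fps_mult_nth const_sum mult.commute)
  qed
  have "[:1 / fact k:] * euler_poly k = fps_nth (?C (2 / (fps_exp 1 + 1)) * ?X) k" for k
    unfolding euler_poly_def mult.assoc[symmetric]
    by (subst mult.commute[of "[:1 / fact k:]"]) (simp only: fact_times_const_poly mult_1_left)
  then have "Abs_fps (\<lambda>k. [:1 / fact k:] * euler_poly k) = ?C (2 / (fps_exp 1 + 1)) * ?X"
    by (simp add: fps_eq_iff)
  moreover have "Abs_fps (\<lambda>n. [:1 / fact n:]) + 1 = ?C (fps_exp 1 + 1)"
    by (rule fps_ext) (simp add: fps_one_nth one_pCons)
  moreover have "?C 2 = 2"
    by (rule fps_ext) (simp add: numeral_poly fps_numeral_nth)
  ultimately show ?thesis
    by (simp only: mult.assoc[symmetric] C_mult two_div_fps_exp_plus_1)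
qed

lemma poly_euler_poly_gen_fun:
  "Abs_fps (\<lambda>k. poly (euler_poly k) x / fact k) =
     2 * fps_exp x / (fps_exp 1 + 1 :: 'a :: field_char_0 fps)"
proof -
  have fact_poly: "poly (fact k) x = fact k" for k
    by (metis of_nat_fact of_nat_poly poly_const_conv)
  have "fps_nth (fps_exp 1 + 1 :: 'a fps) 0 \<noteq> 0" by simp
  from fps_divide_unit[OF this]
  have eq: "2 * fps_exp x / (fps_exp 1 + 1) = 2 / (fps_exp 1 + 1) * fps_exp x"
    by (simp only: mult_ac)
  show ?thesis
    unfolding eq
    by (rule fps_ext)
       (simp add: euler_poly_def fact_poly fps_mult_nth poly_sum poly_monom)
qed

end

(*
  Let N be the linear functional on polynomials with N(y^k) = c_k, where the c_k have exponential
  generating function 2t / (e^(at) + e^(bt)); both sequences are of this form (a = 1 - x, b = -x and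
  a = 1, b = -1). Then N(q(y + a) + q(y + b)) = 2 q'(0) for all q. With s = (a + b)/2, h = (a - b)/2
  and z = y + s, testing this on central factorials gives N(u_k) = 0 and
  N(z u_k) = (-4 h^2)^k k!^2 for u_k = prod_{l<k} (z^2 - h^2 (2l + 1)^2), and hence
  N(z u_k u_j) = (-4 h^2)^(k+j) (k + j)! k! j!, while N vanishes on products even in z.
  The Hankel determinant equals the Gram determinant of the monic basis u_0, z u_0, u_1, z u_1, ...,
  and this Gram matrix is factored explicitly.
*)
theory Submission
  imports Defs
begin

section \<open>Determinants: triangular congruence and swap blocks\<close>

text \<open>The left matrix is L A L^T, and the triangular L has the product of its diagonal as
  determinant. It serves twice: for the change to a monic basis, and for the factorization of the
  Gram matrix.\<close>

lemma det_congruence: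
  fixes A L :: "nat \<Rightarrow> nat \<Rightarrow> 'a :: idom"
  assumes low: "\<And>i j. i < j \<Longrightarrow> L i j = 0"
  shows "Determinant.det (mat n n (\<lambda>(i, j). \<Sum>a<n. \<Sum>b<n. L i a * A a b * L j b))
    = (\<Prod>i<n. L i i) ^ 2 * Determinant.det (mat n n (\<lambda>(i, j). A i j))"
proof -
  define T where "T = mat n n (\<lambda>(i, j). L i j)"
  define M where "M = mat n n (\<lambda>(i, j). A i j)"
  have car [simp]: "T \<in> carrier_mat n n" "M \<in> carrier_mat n n"
    by (simp_all add: T_def M_def)
  have eq: "mat n n (\<lambda>(i, j). \<Sum>a<n. \<Sum>b<n. L i a * A a b * L j b) = T * (M * T\<^sup>T)"
    by (rule eq_matI)
       (auto simp: T_def M_def scalar_prod_def sum_distrib_left mult.assoc atLeast0LessThan)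
  have det_T: "Determinant.det T = (\<Prod>i<n. L i i)"
  proof -
    have "Determinant.det T = prod_list (diag_mat T)"
      by (rule det_lower_triangular[of n]) (use low in \<open>auto simp: T_def\<close>)
    also have "\<dots> = (\<Prod>i<n. L i i)"
      unfolding prod_list_diag_prod by (rule prod.cong) (auto simp: T_def)
    finally show ?thesis .
  qed
  have "Determinant.det (T * (M * T\<^sup>T)) = Determinant.det T * (Determinant.det M * Determinant.det (T\<^sup>T))"
    by (simp add: det_mult[OF car(1) mult_carrier_mat[OF car(2)]] det_mult[OF car(2)])
  also have "\<dots> = (\<Prod>i<n. L i i) ^ 2 * Determinant.det M"
    unfolding det_transpose[OF car(1)] det_T by (simp add: power2_eq_square)
  finally show ?thesis unfolding eq M_def .
qed

text \<open>What remains of the Gram matrix once its triangular factors are split off: the indices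
  2r and 2r + 1 are paired.\<close>

definition swap_block :: "nat \<Rightarrow> nat \<Rightarrow> 'a :: zero_neq_one" where
  "swap_block i j = (if i \<noteq> j \<and> i div 2 = j div 2 then 1 else 0)"

text \<open>The last block is written as the elementary matrix \<open>swaprows_mat 2 0 1\<close>
  because the determinant -1 of that matrix is known.\<close>

lemma swap_block_step_even:
  "mat (2 * m + 2) (2 * m + 2) (\<lambda>(i, j). swap_block i j)
    = four_block_mat (mat (2 * m) (2 * m) (\<lambda>(i, j). swap_block i j)) (0\<^sub>m (2 * m) 2) (0\<^sub>m 2 (2 * m))
        (swaprows_mat 2 0 1 :: 'a :: idom mat)"
proof (rule eq_matI, goal_cases)
  case (1 i j)
  then have "i < 2 * m + 2" "j < 2 * m + 2" by simp_all
  then have "i < 2 * m \<or> i = 2 * m \<or> i = Suc (2 * m)" "j < 2 * m \<or> j = 2 * m \<or> j = Suc (2 * m)"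
    by auto
  then show ?case by (elim disjE) (auto simp: swap_block_def swaprows_mat_def)
qed (simp_all add: swaprows_mat_def)

lemma det_swap_block_even:
  "Determinant.det (mat (2 * m) (2 * m) (\<lambda>(i, j). swap_block i j :: 'a :: idom)) = (- 1) ^ m"
proof (induction m)
  case (Suc m)
  let ?J = "\<lambda>n. mat n n (\<lambda>(i, j). swap_block i j :: 'a)"
  have "Determinant.det (?J (2 * m + 2))
      = Determinant.det (?J (2 * m)) * Determinant.det (swaprows_mat 2 0 1 :: 'a mat)"
    unfolding swap_block_step_even by (rule det_four_block_mat_lower_left_zero) auto
  also have "Determinant.det (swaprows_mat 2 0 1 :: 'a mat) = -1"
    by (rule det_swaprows_mat) auto
  also note Suc.IH
  finally show ?case by simp
qed simp

text \<open>The last index \<open>2 * m\<close> has no partner, so it forms a zero block of size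
  1.\<close>

lemma det_swap_block_odd:
  "Determinant.det (mat (2 * m + 1) (2 * m + 1) (\<lambda>(i, j). swap_block i j :: 'a :: idom)) = 0"
proof -
  let ?J = "\<lambda>n. mat n n (\<lambda>(i, j). swap_block i j :: 'a)"
  have "?J (2 * m + 1) = four_block_mat (?J (2 * m)) (0\<^sub>m (2 * m) 1) (0\<^sub>m 1 (2 * m)) (0\<^sub>m 1 1)"
  proof (rule eq_matI, goal_cases)
    case (1 i j)
    then have "i < 2 * m + 1" "j < 2 * m + 1" by simp_all
    then have "i < 2 * m \<or> i = 2 * m" "j < 2 * m \<or> j = 2 * m"
      by auto
    then show ?case by (elim disjE) (auto simp: swap_block_def)
  qed simp_all
  then have "Determinant.det (?J (2 * m + 1)) = Determinant.det (?J (2 * m)) * Determinant.det (0\<^sub>m 1 1 :: 'a mat)"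
    by (simp only:) (rule det_four_block_mat_lower_left_zero, auto)
  also have "Determinant.det (0\<^sub>m 1 1 :: 'a mat) = 0"
    by (subst det_single) auto
  finally show ?thesis by (simp only: mult_zero_right)
qed

text \<open>Evaluation at x is a ring homomorphism. This reduces the case of a formal variable to
  that of scalars.\<close>

lemma poly_hankel_det: "poly (hankel_det n c) x = hankel_det n (\<lambda>k. poly (c k) x)"
proof -
  interpret comm_ring_hom "\<lambda>p. poly p x" by unfold_locales auto
  show ?thesis unfolding hankel_det_def
    by (subst hom_det[symmetric]) (rule arg_cong[of _ _ Determinant.det], rule eq_matI, auto)
qed

text \<open>Vandermonde's identity for (k + j) choose k. Each summand is a function of (k, r) times
  the same function of (j, r), which is the shape of a factorization W W^T.\<close>

lemma fact_add_factor:
  "fact (k + j) * fact k * fact j =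
    (\<Sum>r\<le>k. (fact k)\<^sup>2 * of_nat (k choose r) * ((fact j)\<^sup>2 * of_nat (j choose r)) :: 'a :: field_char_0)"
proof -
  have "(\<Sum>r\<le>k. (k choose r) * (j choose r)) = (\<Sum>r\<le>k. (j choose r) * (k choose (k - r)))"
    by (rule sum.cong) (auto simp: binomial_symmetric[symmetric] mult.commute)
  also have "\<dots> = (k + j) choose k" by (simp add: vandermonde add.commute)
  finally have eq: "(\<Sum>r\<le>k. of_nat ((k choose r) * (j choose r))) = (fact (k + j) / (fact k * fact j) :: 'a)"
    unfolding of_nat_sum[symmetric] by (simp add: binomial_fact)
  have "(\<Sum>r\<le>k. (fact k)\<^sup>2 * of_nat (k choose r) * ((fact j)\<^sup>2 * of_nat (j choose r)))
    = (fact k)\<^sup>2 * (fact j)\<^sup>2 * (\<Sum>r\<le>k. of_nat ((k choose r) * (j choose r)) :: 'a)"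
    unfolding sum_distrib_left by (rule sum.cong) (simp_all only: of_nat_mult mult_ac)
  then show ?thesis unfolding eq by (simp add: power2_eq_square)
qed

section \<open>The linear functional with prescribed moments\<close>

definition moment :: "(nat \<Rightarrow> 'a) \<Rightarrow> 'a poly \<Rightarrow> 'a :: comm_ring_1" where
  "moment c p = (\<Sum>k\<le>degree p. coeff p k * c k)"

text \<open>Frees the summation bound from the degree, so that several polynomials can be summed
  over one common range.\<close>

lemma moment_eq_sum: "degree p < n \<Longrightarrow> moment c p = (\<Sum>k<n. coeff p k * c k)"
  unfolding moment_def by (rule sum.mono_neutral_left) (auto simp: coeff_eq_0)

lemma moment_add: "moment c (p + q) = moment c p + moment c q"
proof -
  define n where "n = Suc (max (degree p) (degree q))"
  have "degree p < n" "degree q < n" "degree (p + q) < n"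
    using degree_add_le_max[of p q] by (auto simp: n_def)
  then show ?thesis by (simp add: moment_eq_sum[of _ n] sum.distrib ring_distribs)
qed

lemma moment_smult: "moment c (Polynomial.smult a p) = a * moment c p"
  using degree_smult_le[of a p]
  by (simp add: moment_eq_sum[of _ "Suc (degree p)"] sum_distrib_left mult.assoc del: sum.lessThan_Suc)

lemma moment_monom: "moment c (monom a n) = a * c n"
  using degree_monom_le[of a n]
  by (simp add: moment_eq_sum[of _ "Suc n"] if_distrib[of "\<lambda>x. x * _"] cong: if_cong)

lemma moment_sum: "moment c (\<Sum>i\<in>A. f i) = (\<Sum>i\<in>A. moment c (f i))"
  by (induction A rule: infinite_finite_induct) (simp_all add: moment_add moment_def[of c 0])

lemma poly_eq_sum_monom: "degree p < n \<Longrightarrow> p = (\<Sum>k<n. monom (coeff p k) k)"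
  using poly_as_sum_of_monoms'[of p "n - 1"] by (cases n) (auto simp: lessThan_Suc_atMost)

text \<open>In the monomial basis, the bilinear form that sends p, q to
  \<open>moment c (p * q)\<close> has the Hankel matrix of c as Gram matrix. The double sum has the
  form used in \<open>det_congruence\<close>.\<close>

lemma moment_mult:
  assumes "degree p < n" "degree q < n"
  shows "moment c (p * q) = (\<Sum>a<n. \<Sum>b<n. coeff p a * c (a + b) * coeff q b)"
proof -
  have "p * q = (\<Sum>a<n. \<Sum>b<n. monom (coeff p a * coeff q b) (a + b))"
    by (subst poly_eq_sum_monom[OF assms(1)], subst poly_eq_sum_monom[OF assms(2)])
       (simp add: sum_product mult_monom)
  then show ?thesis by (simp add: moment_sum moment_monom mult_ac)
qed

lemma pcompose_power: "pcompose (p ^ n) q = pcompose p q ^ n"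
  by (induction n) (simp_all add: pcompose_1 pcompose_mult)

text \<open>Applied coefficientwise, the functional sends e^(yt) to the exponential generating
  function of c, so replacing y by y + \<alpha> multiplies that series by e^(\<alpha>t).\<close>

lemma moment_shift:
  fixes \<alpha> :: "'a :: field_char_0"
  assumes "Abs_fps (\<lambda>k. c' k / fact k) = fps_exp \<alpha> * Abs_fps (\<lambda>k. c k / fact k)"
  shows "moment c (pcompose p [:\<alpha>, 1:]) = moment c' p"
proof -
  have c': "c' n = (\<Sum>k\<le>n. of_nat (n choose k) * \<alpha> ^ (n - k) * c k)" for n
  proof -
    have "c' n / fact n = (\<Sum>k\<le>n. \<alpha> ^ (n - k) / fact (n - k) * (c k / fact k))"
      using arg_cong[OF trans[OF assms mult.commute], of "\<lambda>f. fps_nth f n"]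
      unfolding fps_mult_nth by (simp add: atMost_atLeast0 mult_ac)
    then have "c' n = (\<Sum>k\<le>n. fact n * (\<alpha> ^ (n - k) / fact (n - k) * (c k / fact k)))"
      unfolding sum_distrib_left[symmetric] by (simp add: field_simps)
    also have "\<dots> = (\<Sum>k\<le>n. of_nat (n choose k) * \<alpha> ^ (n - k) * c k)"
      by (rule sum.cong) (auto simp: binomial_fact field_simps)
    finally show ?thesis .
  qed
  have pow: "moment c ([:\<alpha>, 1:] ^ n) = c' n" for n
  proof -
    have "[:\<alpha>, 1:] ^ n = (monom 1 1 + [:\<alpha>:]) ^ n" by (simp add: monom_altdef)
    also have "\<dots> = (\<Sum>k\<le>n. of_nat (n choose k) * monom 1 1 ^ k * [:\<alpha>:] ^ (n - k))"
      by (rule binomial_ring)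
    also have "\<dots> = (\<Sum>k\<le>n. monom (of_nat (n choose k) * \<alpha> ^ (n - k)) k)"
      by (rule sum.cong) (auto simp: monom_power poly_const_pow of_nat_poly smult_monom mult.commute)
    finally show ?thesis by (simp add: moment_sum moment_monom c')
  qed
  have "pcompose p [:\<alpha>, 1:] = (\<Sum>k<Suc (degree p). Polynomial.smult (coeff p k) ([:\<alpha>, 1:] ^ k))"
    by (subst poly_eq_sum_monom[of p "Suc (degree p)"])
       (simp_all add: pcompose_sum monom_altdef pcompose_smult pcompose_power pcompose_pCons del: sum.lessThan_Suc)
  then show ?thesis
    by (simp add: moment_sum moment_smult pow moment_eq_sum[of p "Suc (degree p)"] del: sum.lessThan_Suc)
qed

text \<open>By \<open>moment_shift\<close> the two terms are functionals whose generating functions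
  add up to 2t, so their sum sees only the coefficient of y.\<close>

lemma moment_euler_identity:
  fixes \<alpha> \<beta> :: "'a :: field_char_0"
  assumes gf: "(fps_exp \<alpha> + fps_exp \<beta>) * Abs_fps (\<lambda>k. c k / fact k) = 2 * fps_X"
  shows "moment c (pcompose q [:\<alpha>, 1:]) + moment c (pcompose q [:\<beta>, 1:]) = 2 * coeff q 1"
proof -
  define C where "C = Abs_fps (\<lambda>k. c k / fact k)"
  define d where "d \<gamma> k = fact k * fps_nth (fps_exp \<gamma> * C) k" for \<gamma> k
  have "Abs_fps (\<lambda>k. d \<gamma> k / fact k) = fps_exp \<gamma> * C" for \<gamma>
    by (rule fps_ext) (simp add: d_def)
  then have "moment c (pcompose q [:\<gamma>, 1:]) = moment (d \<gamma>) q" for \<gamma>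
    by (intro moment_shift) (simp add: C_def)
  moreover have "d \<alpha> k + d \<beta> k = (if k = 1 then 2 else 0)" for k
    using arg_cong[OF gf, of "\<lambda>f. fact k * fps_nth f k"]
    by (auto simp: d_def C_def distrib_right distrib_left fps_numeral_fps_const)
  \<comment> \<open>The range reaches \<open>degree q + 1\<close>, so it contains the index 1 even
    when q is constant.\<close>
  ultimately have "moment c (pcompose q [:\<alpha>, 1:]) + moment c (pcompose q [:\<beta>, 1:])
      = (\<Sum>k<Suc (Suc (degree q)). coeff q k * (if k = 1 then 2 else 0))"
    by (simp add: moment_eq_sum[of q "Suc (Suc (degree q))"] del: sum.lessThan_Suc flip: sum.distrib distrib_left)
  also have "\<dots> = 2 * coeff q 1"
    by (simp add: if_distrib[of "\<lambda>x. _ * x"] del: sum.lessThan_Suc cong: if_cong)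
  finally show ?thesis .
qed

section \<open>Central factorials and their shifts\<close>

text \<open>
  Central factorials with step \<open>2 h\<close>: \<open>central_odd\<close> vanishes at even multiples of \<open>h\<close>,
  \<open>central_even\<close> at odd ones (centred at \<open>- s\<close>), so a shift by \<open>h\<close> exchanges them up to a linear factor.
\<close>

definition central_odd :: "'a :: field_char_0 \<Rightarrow> nat \<Rightarrow> 'a poly" where
  "central_odd h k = [:0, 1:] * (\<Prod>l<k. [:0, 1:] ^ 2 - [:(2 * h * of_nat (Suc l)) ^ 2:])"

definition central_even :: "'a :: field_char_0 \<Rightarrow> 'a \<Rightarrow> nat \<Rightarrow> 'a poly" where
  "central_even s h k = (\<Prod>l<k. [:s, 1:] ^ 2 - [:(h * of_nat (2 * l + 1)) ^ 2:])"

lemma central_even_0 [simp]: "central_even s h 0 = 1"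
  by (simp add: central_even_def)

lemma central_even_Suc:
  "central_even s h (Suc k) = central_even s h k * ([:s, 1:] ^ 2 - [:(h * of_nat (2 * k + 1)) ^ 2:])"
  by (simp add: central_even_def)

lemma central_even_minus: "central_even s (- h) k = central_even s h k"
  by (simp add: central_even_def)

lemma central_odd_minus: "central_odd (- h) k = central_odd h k"
  by (simp add: central_odd_def)

text \<open>In terms of z = x + s, the zeros -2kh, ..., 2kh move to -(2k + 1)h, ..., (2k - 1)h in
  steps of 2h. The first gives the linear factor, the others are the zeros of
  \<open>central_even s h k\<close>.\<close>

lemma poly_central_odd_shift:
  "poly (central_odd h k) (x + s + h) = poly (central_even s h k) x * (x + s + of_nat (2 * k + 1) * h)"
proof (induction k)
  case (Suc k)
  have "poly (central_odd h (Suc k)) (x + s + h)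
      = poly (central_odd h k) (x + s + h) * ((x + s + h) ^ 2 - (2 * h * of_nat (Suc k)) ^ 2)"
    by (simp add: central_odd_def)
  also have "\<dots> = poly (central_even s h (Suc k)) x * (x + s + of_nat (2 * Suc k + 1) * h)"
    unfolding Suc.IH by (simp add: central_even_Suc power2_eq_square algebra_simps)
  finally show ?case .
qed (simp add: central_odd_def)

lemma poly_central_odd_shift':
  "poly (central_odd h k) (x + s - h) = poly (central_even s h k) x * (x + s - of_nat (2 * k + 1) * h)"
  using poly_central_odd_shift[of "- h" k x s] by (simp add: central_even_minus central_odd_minus)

text \<open>With z = x + s the sum is u_k ((z + h)(z + (2k + 1)h) + (z - h)(z - (2k + 1)h)) = 2 u_k
  (z^2 + (2k + 1)h^2), and z^2 u_k = u_(k+1) + (2k + 1)^2 h^2 u_k.\<close>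

lemma central_odd_shift_even:
  "pcompose ([:0, 1:] * central_odd h k) [:s + h, 1:] + pcompose ([:0, 1:] * central_odd h k) [:s - h, 1:]
    = Polynomial.smult 2 (central_even s h (Suc k))
      + Polynomial.smult (2 * h ^ 2 * of_nat ((2 * k + 1) * (2 * k + 2))) (central_even s h k)"
proof -
  have shift: "poly (central_odd h k) (s + h + x) = poly (central_even s h k) x * (x + s + of_nat (2 * k + 1) * h)"
    "poly (central_odd h k) (s - h + x) = poly (central_even s h k) x * (x + s - of_nat (2 * k + 1) * h)" for x
    using poly_central_odd_shift[of h k x s] poly_central_odd_shift'[of h k x s]
    by (simp_all add: add.commute add.left_commute add_diff_eq diff_add_eq)
  show ?thesis
    by (intro poly_eq_poly_eq_iff[THEN iffD1] ext)
       (simp add: poly_pcompose shift central_even_Suc, simp add: power2_eq_square algebra_simps)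
qed

text \<open>Here the sum is 2 z u_k (z^2 + (4k + 3)h^2), and (2k + 1)^2 + 4k + 3 = 4(k +
  1)^2.\<close>

lemma central_odd_shift_odd:
  "pcompose ([:0, 1:] ^ 2 * central_odd h k) [:s + h, 1:] + pcompose ([:0, 1:] ^ 2 * central_odd h k) [:s - h, 1:]
    = Polynomial.smult 2 ([:s, 1:] * central_even s h (Suc k))
      + Polynomial.smult (8 * h ^ 2 * of_nat (Suc k) ^ 2) ([:s, 1:] * central_even s h k)"
proof -
  have shift: "poly (central_odd h k) (s + h + x) = poly (central_even s h k) x * (x + s + of_nat (2 * k + 1) * h)"
    "poly (central_odd h k) (s - h + x) = poly (central_even s h k) x * (x + s - of_nat (2 * k + 1) * h)" for x
    using poly_central_odd_shift[of h k x s] poly_central_odd_shift'[of h k x s]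
    by (simp_all add: add.commute add.left_commute add_diff_eq diff_add_eq)
  show ?thesis
    by (intro poly_eq_poly_eq_iff[THEN iffD1] ext)
       (simp add: poly_pcompose shift central_even_Suc, simp add: power2_eq_square algebra_simps)
qed

definition central_basis :: "'a :: field_char_0 \<Rightarrow> 'a \<Rightarrow> nat \<Rightarrow> 'a poly" where
  "central_basis s h i = [:s, 1:] ^ (i mod 2) * central_even s h (i div 2)"

lemma degree_lead_coeff_central_even:
  "degree (central_even s h k) = 2 * k \<and> lead_coeff (central_even s h k) = 1"
proof (induction k)
  case (Suc k)
  let ?q = "[:s, 1:] ^ 2 - [:(h * of_nat (2 * k + 1)) ^ 2:]"
  have "?q = [:s ^ 2 - (h * of_nat (2 * k + 1)) ^ 2, 2 * s, 1:]"
    by (simp add: power2_eq_square)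
  then have q: "degree ?q = 2" "lead_coeff ?q = 1" by (simp_all del: of_nat_add of_nat_mult)
  then have "?q \<noteq> 0" by force
  moreover have "central_even s h k \<noteq> 0" using Suc by auto
  ultimately have "degree (central_even s h k * ?q) = 2 * k + 2"
    using Suc q by (metis degree_mult_eq)
  then have "degree (central_even s h (Suc k)) = 2 * Suc k"
    unfolding central_even_Suc by simp
  moreover have "lead_coeff (central_even s h (Suc k)) = 1"
    using conjunct2[OF Suc.IH] q(2) unfolding central_even_Suc lead_coeff_mult by (metis mult_1_left)
  ultimately show ?case by blast
qed simp

lemma degree_lead_coeff_central_basis:
  "degree (central_basis s h i) = i" "lead_coeff (central_basis s h i) = 1"
proof -
  have "central_even s h (i div 2) \<noteq> 0"
    using degree_lead_coeff_central_even[of s h "i div 2"] by auto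
  then show "degree (central_basis s h i) = i"
    using degree_lead_coeff_central_even[of s h "i div 2"]
    by (simp add: central_basis_def degree_mult_eq degree_power_eq)
  show "lead_coeff (central_basis s h i) = 1"
    unfolding central_basis_def lead_coeff_mult lead_coeff_power
      conjunct2[OF degree_lead_coeff_central_even] by simp
qed

section \<open>Moments of products of the basis polynomials\<close>

text \<open>The exponents are given by their midpoint s and half-difference h, and the generating
  function is stated multiplied out, which is the form that the shift identity takes.\<close>

locale euler_moments =
  fixes c :: "nat \<Rightarrow> 'a :: field_char_0" and s h :: 'a
  assumes gf: "(fps_exp (s + h) + fps_exp (s - h)) * Abs_fps (\<lambda>k. c k / fact k) = 2 * fps_X"
begin

abbreviation "\<mu> \<equiv> moment c"
abbreviation "z \<equiv> [:s, 1:]"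
abbreviation "u \<equiv> central_even s h"
abbreviation "e \<equiv> - 4 * h ^ 2"

lemma moment_identity: "\<mu> (pcompose q [:s + h, 1:] + pcompose q [:s - h, 1:]) = 2 * coeff q 1"
  using moment_euler_identity[OF gf] by (simp add: moment_add)

text \<open>The test polynomial y \<open>central_odd h k\<close> is divisible by y^2, so the right
  side of \<open>moment_identity\<close> vanishes and the moment of \<open>u (Suc k)\<close> is a
  multiple of that of \<open>u k\<close>.\<close>

lemma moment_even: "\<mu> (u k) = 0"
proof (induction k)
  case 0
  show ?case using moment_identity[of 1] unfolding moment_add pcompose_1 by simp
next
  case (Suc k)
  have "\<mu> (Polynomial.smult 2 (u (Suc k))) = 0"
    using moment_identity[of "[:0, 1:] * central_odd h k"] Suc
    unfolding central_odd_shift_even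
    by (simp add: moment_add moment_smult central_odd_def)
  then show ?case by (simp add: moment_smult)
qed

text \<open>The test polynomial y^2 \<open>central_odd h k\<close> has no linear term, which gives a
  recursion with factor -4 h^2 (k + 1)^2. The start \<open>\<mu> z = 1\<close> comes from the test
  polynomial y, whose two shifts add up to 2z.\<close>

lemma moment_odd: "\<mu> (z * u k) = e ^ k * (fact k) ^ 2"
proof (induction k)
  case 0
  have "2 * \<mu> z = \<mu> (pcompose [:0, 1:] [:s + h, 1:] + pcompose [:0, 1:] [:s - h, 1:])"
    by (simp add: pcompose_pCons moment_smult[symmetric])
  then show ?case using moment_identity[of "[:0, 1:]"] by simp
next
  case (Suc k)
  have eq0: "2 * \<mu> (z * u (Suc k)) + 8 * h ^ 2 * of_nat (Suc k) ^ 2 * \<mu> (z * u k) = 0"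
    using moment_identity[of "[:0, 1:] ^ 2 * central_odd h k"]
    unfolding central_odd_shift_odd moment_add moment_smult
    by (simp add: central_odd_def power2_eq_square)
  \<comment> \<open>Solves the recursion for the new moment, with x = h^2 and y = (k + 1)^2.\<close>
  have cancel: "A = - 4 * x * y * B" if "2 * A + 8 * x * y * B = 0" for A B x y :: 'a
  proof -
    have "2 * (A + 4 * x * y * B) = 0" using that by (simp add: algebra_simps)
    then have "A + 4 * x * y * B = 0" by (simp only: mult_eq_0_iff) simp
    then show ?thesis by (simp add: eq_neg_iff_add_eq_0)
  qed
  have "\<mu> (z * u (Suc k)) = e * of_nat (Suc k) ^ 2 * \<mu> (z * u k)"
    by (rule cancel[OF eq0])
  then show ?case unfolding Suc.IH by (simp add: power_mult_distrib mult_ac)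
qed

text \<open>
  \<open>u\<^bsub>k+1\<^esub>/u\<^bsub>k\<^esub> - u\<^bsub>j+1\<^esub>/u\<^bsub>j\<^esub>\<close> is a constant, so every moment of \<open>w u\<^bsub>k\<^esub> u\<^bsub>j\<^esub>\<close> is determined by those
  with \<open>j = 0\<close>.
\<close>

lemma moment_exchange:
  "\<mu> (w * (u k * u (Suc j)))
    = \<mu> (w * (u (Suc k) * u j)) + e * ((of_nat j - of_nat k) * of_nat (Suc (k + j))) * \<mu> (w * (u k * u j))"
proof -
  have eq: "w * (u k * u (Suc j)) = w * (u (Suc k) * u j)
      + Polynomial.smult (e * ((of_nat j - of_nat k) * of_nat (Suc (k + j)))) (w * (u k * u j))"
    by (intro poly_eq_poly_eq_iff[THEN iffD1] ext)
       (simp add: central_even_Suc power2_eq_square algebra_simps)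
  show ?thesis by (simp only: eq moment_add moment_smult)
qed

text \<open>Exchange with weight 1 lowers j until \<open>moment_even\<close> applies. As it raises
  k, the induction keeps k arbitrary.\<close>

lemma moment_even_even: "\<mu> (u k * u j) = 0"
proof (induction j arbitrary: k)
  case (Suc j)
  then show ?case using moment_exchange[of 1 k j] by simp
qed (simp add: moment_even)

text \<open>The factor z^2 is absorbed by passing from \<open>u k\<close> to
  \<open>u (Suc k)\<close>, up to a multiple of \<open>u k\<close>.\<close>

lemma moment_odd_odd: "\<mu> (z ^ 2 * (u k * u j)) = 0"
proof -
  have "z ^ 2 * (u k * u j) = u (Suc k) * u j + Polynomial.smult ((h * of_nat (2 * k + 1)) ^ 2) (u k * u j)"
    by (intro poly_eq_poly_eq_iff[THEN iffD1] ext) (simp add: central_even_Suc algebra_simps)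
  then show ?thesis by (simp only: moment_add moment_smult moment_even_even mult_zero_right add_0_left)
qed

text \<open>The closed form satisfies the exchange recursion because (k + 1) + (j - k) = j +
  1.\<close>

lemma moment_odd_even: "\<mu> (z * (u k * u j)) = e ^ (k + j) * (fact (k + j) * fact k * fact j)"
proof (induction j arbitrary: k)
  case 0
  then show ?case using moment_odd[of k] by (simp add: power2_eq_square)
next
  case (Suc j)
  show ?case
    unfolding moment_exchange Suc.IH by (simp add: algebra_simps)
qed

lemma moment_basis:
  "\<mu> (central_basis s h i * central_basis s h j) =
    (if even (i + j) then 0
     else e ^ (i div 2 + j div 2) * (fact (i div 2 + j div 2) * fact (i div 2) * fact (j div 2)))"
proof (cases "even i"; cases "even j")
  assume "odd i" "odd j"
  then have par: "i mod 2 = 1" "j mod 2 = 1" "even (i + j)" by presburger+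
  have "central_basis s h i * central_basis s h j = z ^ 2 * (u (i div 2) * u (j div 2))"
    by (simp only: central_basis_def par power_one_right power2_eq_square mult_ac)
  then show ?thesis using par(3) by (simp only: moment_odd_odd if_True)
next
  assume "odd i" "even j"
  then have par: "i mod 2 = 1" "j mod 2 = 0" "odd (i + j)" by presburger+
  have "central_basis s h i * central_basis s h j = z * (u (i div 2) * u (j div 2))"
    by (simp only: central_basis_def par power_one_right power_0 mult_1_left mult_ac)
  then show ?thesis using par(3) by (simp only: moment_odd_even if_False)
next
  assume "even i" "odd j"
  then have par: "i mod 2 = 0" "j mod 2 = 1" "odd (i + j)" by presburger+
  have "central_basis s h i * central_basis s h j = z * (u (i div 2) * u (j div 2))"
    by (simp only: central_basis_def par power_one_right power_0 mult_1_left mult_ac)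
  then show ?thesis using par(3) by (simp only: moment_odd_even if_False)
next
  assume "even i" "even j"
  then have par: "i mod 2 = 0" "j mod 2 = 0" "even (i + j)" by presburger+
  have "central_basis s h i * central_basis s h j = u (i div 2) * u (j div 2)"
    by (simp only: central_basis_def par power_0 mult_1_left)
  then show ?thesis using par(3) by (simp only: moment_even_even if_True)
qed

section \<open>Factorization of the Gram matrix and the Hankel determinants\<close>

text \<open>
  By the Vandermonde identity the Gram matrix of the basis is \<open>W J W\<^sup>T\<close> with \<open>W\<close> lower triangular and
  \<open>J\<close> made of \<open>2 \<times> 2\<close> swap blocks; in odd dimension \<open>J\<close> ends in a zero row.
\<close>

definition gram_factor :: "nat \<Rightarrow> nat \<Rightarrow> 'a" where
  "gram_factor i a = (if even (i + a) then e ^ (i div 2) * (fact (i div 2))\<^sup>2 * of_nat ((i div 2) choose (a div 2)) else 0)"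

lemma gram_factor_eq_0: "i < a \<Longrightarrow> gram_factor i a = 0"
  by (auto simp: gram_factor_def elim!: evenE oddE intro!: binomial_eq_0)

text \<open>A nonzero term needs a and b to be the two distinct indices of one pair, with the
  parities of i and j. For even i + j this is impossible; otherwise the pairs are numbered by r and
  \<open>fact_add_factor\<close> sums them.\<close>

lemma gram_eq_swap_block:
  assumes "i < n" "j < n"
  shows "(\<Sum>a<n. \<Sum>b<n. gram_factor i a * swap_block a b * gram_factor j b) = \<mu> (central_basis s h i * central_basis s h j)"
proof (cases "even (i + j)")
  case True
  have "gram_factor i a * swap_block a b * gram_factor j b = 0" for a b
  proof (rule ccontr)
    assume "gram_factor i a * swap_block a b * gram_factor j b \<noteq> 0"
    then have "even (i + a)" "even (j + b)" "a \<noteq> b" "a div 2 = b div 2"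
      by (auto simp: gram_factor_def swap_block_def split: if_splits)
    with True show False by presburger
  qed
  then show ?thesis using True by (simp only: sum.neutral_const moment_basis if_True)
next
  case False
  define k l where "k = i div 2" and "l = j div 2"
  let ?W = "\<lambda>k r. e ^ k * (fact k)\<^sup>2 * of_nat (k choose r)"
  let ?P = "{(a, b) \<in> {..<n} \<times> {..<n}. even (i + a) \<and> even (j + b) \<and> a div 2 = b div 2}"
  let ?R = "{r. 2 * r + i mod 2 < n \<and> 2 * r + j mod 2 < n}"
  have "(\<Sum>a<n. \<Sum>b<n. gram_factor i a * swap_block a b * gram_factor j b)
      = (\<Sum>(a, b)\<in>{..<n} \<times> {..<n}. gram_factor i a * swap_block a b * gram_factor j b)"
    by (simp add: sum.cartesian_product)
  also have "\<dots> = (\<Sum>(a, b)\<in>?P. gram_factor i a * swap_block a b * gram_factor j b)"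
    by (rule sum.mono_neutral_right) (auto simp: gram_factor_def swap_block_def split: if_splits)
  also have "\<dots> = (\<Sum>r\<in>?R. ?W k r * ?W l r)"
  \<comment> \<open>The common half r determines a and b, since their parities are those of i and
    j.\<close>
  proof (rule sum.reindex_bij_witness[where
        i = "\<lambda>r. (2 * r + i mod 2, 2 * r + j mod 2)" and j = "\<lambda>(a, b). a div 2"])
    fix p assume P: "p \<in> ?P"
    obtain a b where p_eq: "p = (a, b)" by (rule prod.exhaust)
    have p: "p = (a, b)" "a < n" "b < n" and par: "even (i + a)" "even (j + b)" and ab: "a div 2 = b div 2"
      using P by (simp_all only: p_eq mem_Collect_eq case_prod_conv mem_Sigma_iff lessThan_iff)
    have "i mod 2 = a mod 2" using par(1) by presburger
    moreover have "j mod 2 = b mod 2" using par(2) by presburger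
    ultimately have eqs: "2 * (a div 2) + i mod 2 = a" "2 * (a div 2) + j mod 2 = b"
      using ab mult_div_mod_eq[of 2 a] mult_div_mod_eq[of 2 b] by simp_all
    have "a \<noteq> b" using par False by presburger
    then show "?W k (case p of (a, b) \<Rightarrow> a div 2) * ?W l (case p of (a, b) \<Rightarrow> a div 2)
        = (case p of (a, b) \<Rightarrow> gram_factor i a * swap_block a b * gram_factor j b)"
      using p par ab by (simp add: gram_factor_def swap_block_def k_def l_def)
    show "(2 * (case p of (a, b) \<Rightarrow> a div 2) + i mod 2, 2 * (case p of (a, b) \<Rightarrow> a div 2) + j mod 2) = p"
      and "(case p of (a, b) \<Rightarrow> a div 2) \<in> ?R"
      using p eqs by simp_all
  next
    fix r assume r: "r \<in> ?R"
    have "even (i + (2 * r + i mod 2))" "even (j + (2 * r + j mod 2))" by presburger+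
    then show "(2 * r + i mod 2, 2 * r + j mod 2) \<in> ?P" using r by auto
  qed simp
  also have "\<dots> = (\<Sum>r\<le>k. ?W k r * ?W l r)"
  proof (rule sum.mono_neutral_cong)
    show "finite ?R" by (rule finite_subset[of _ "{..n}"]) auto
    \<comment> \<open>Such an r arises only for odd n, from the unpaired last index. There r exceeds
      l, so \<open>l choose r\<close> vanishes.\<close>
    show "?W k r * ?W l r = 0" if "r \<in> {..k} - ?R" for r
    proof -
      have "l < r"
      proof (rule ccontr)
        assume "\<not> l < r"
        then have "2 * r \<le> 2 * (i div 2)" "2 * r \<le> 2 * (j div 2)"
          using that by (simp_all add: k_def l_def)
        moreover have "2 * (i div 2) + i mod 2 = i" "2 * (j div 2) + j mod 2 = j" by simp_all
        ultimately have "2 * r + i mod 2 < n" "2 * r + j mod 2 < n" using assms by linarith+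
        then show False using that by simp
      qed
      then show ?thesis by (simp add: binomial_eq_0)
    qed
  qed (auto simp: binomial_eq_0)
  also have "\<dots> = e ^ (k + l) * (\<Sum>r\<le>k. (fact k)\<^sup>2 * of_nat (k choose r) * ((fact l)\<^sup>2 * of_nat (l choose r)))"
    unfolding sum_distrib_left by (rule sum.cong) (simp_all only: power_add mult_ac)
  also have "\<dots> = e ^ (k + l) * (fact (k + l) * fact k * fact l)"
    unfolding fact_add_factor ..
  finally show ?thesis using False by (simp add: moment_basis k_def l_def)
qed

text \<open>Two congruences: the coefficient matrix of the monic basis is unit lower triangular, so
  the Hankel and Gram determinants agree, and the Gram matrix then splits by
  \<open>gram_eq_swap_block\<close>.\<close>

lemma hankel_det_eq_prod:
  "hankel_det n c = (\<Prod>i<Suc n. e ^ (i div 2) * (fact (i div 2))\<^sup>2) ^ 2 *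
     Determinant.det (mat (Suc n) (Suc n) (\<lambda>(i, j). swap_block i j))"
proof -
  let ?b = "central_basis s h"
  have gram: "\<mu> (?b i * ?b j) = (\<Sum>a<Suc n. \<Sum>b<Suc n. coeff (?b i) a * c (a + b) * coeff (?b j) b)"
    if "i < Suc n" "j < Suc n" for i j
    using that by (intro moment_mult) (simp_all add: degree_lead_coeff_central_basis)
  have "coeff (?b i) i = 1" for i
    using degree_lead_coeff_central_basis[of s h i] by simp
  moreover have "i < j \<Longrightarrow> coeff (?b i) j = 0" for i j
    by (rule coeff_eq_0) (simp add: degree_lead_coeff_central_basis)
  ultimately have "hankel_det n c =
      Determinant.det (mat (Suc n) (Suc n) (\<lambda>(i, j).
        \<Sum>a<Suc n. \<Sum>b<Suc n. coeff (?b i) a * c (a + b) * coeff (?b j) b))"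
    using det_congruence[of "\<lambda>i a. coeff (?b i) a" "Suc n" "\<lambda>a b. c (a + b)"]
    by (simp add: hankel_det_def)
  also have "mat (Suc n) (Suc n) (\<lambda>(i, j). \<Sum>a<Suc n. \<Sum>b<Suc n. coeff (?b i) a * c (a + b) * coeff (?b j) b)
      = mat (Suc n) (Suc n) (\<lambda>(i, j). \<Sum>a<Suc n. \<Sum>b<Suc n. gram_factor i a * swap_block a b * gram_factor j b)"
    by (rule eq_matI) (simp_all add: gram[symmetric] gram_eq_swap_block del: sum.lessThan_Suc)
  also have "Determinant.det \<dots> = (\<Prod>i<Suc n. gram_factor i i) ^ 2 *
     Determinant.det (mat (Suc n) (Suc n) (\<lambda>(i, j). swap_block i j))"
    by (rule det_congruence) (rule gram_factor_eq_0)
  finally show ?thesis by (simp add: gram_factor_def del: prod.lessThan_Suc)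
qed

text \<open>\<open>hankel_det (2 * m)\<close> belongs to a matrix of odd size 2m + 1.\<close>

lemma hankel_det_even: "hankel_det (2 * m) c = 0"
  using det_swap_block_odd[of m, where 'a = 'a] by (simp add: hankel_det_eq_prod)

text \<open>The m + 1 swap blocks give the sign. Each k \<le> m occurs for two indices and is
  squared, contributing e^(4k) k!^8 with e^(4k) = (2h)^(8k); the exponents 8k add up to 4m(m +
  1).\<close>

lemma hankel_det_odd:
  "hankel_det (2 * m + 1) c = (- 1) ^ (m + 1) * (2 * h) ^ (4 * m * (m + 1)) * (\<Prod>l = 1..m. fact l ^ 8)"
proof -
  have "(\<Prod>i<2 * m + 2. e ^ (i div 2) * (fact (i div 2))\<^sup>2) ^ 2
      = (2 * h) ^ (4 * m * (m + 1)) * (\<Prod>l = 1..m. fact l ^ 8)"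
  proof (induction m)
    case 0
    then show ?case by (simp add: numeral_2_eq_2)
  next
    case (Suc m)
    have e: "e ^ k * e ^ k = (2 * h) ^ (4 * k)" for k
    proof -
      have "e ^ k * e ^ k = (e * e) ^ k" by (rule power_mult_distrib[symmetric])
      also have "e * e = (2 * h) ^ 4" by (simp add: power_mult_distrib power4_eq_xxxx power2_eq_square)
      finally show ?thesis by (simp add: power_mult)
    qed
    \<comment> \<open>The new indices 2m + 2 and 2m + 3 both have half m + 1.\<close>
    have "(\<Prod>i<2 * Suc m + 2. e ^ (i div 2) * (fact (i div 2))\<^sup>2)
       = (\<Prod>i<2 * m + 2. e ^ (i div 2) * (fact (i div 2))\<^sup>2) * (e ^ Suc m * (fact (Suc m))\<^sup>2) ^ 2"
      by (simp add: power2_eq_square del: power_Suc fact_Suc)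
    moreover have "((y * F\<^sup>2)\<^sup>2)\<^sup>2 = (y * y)\<^sup>2 * F ^ 8" for y F :: 'a
      by (simp add: power_mult_distrib power2_eq_square[of y] flip: power_mult power_add)
    ultimately have "(\<Prod>i<2 * Suc m + 2. e ^ (i div 2) * (fact (i div 2))\<^sup>2) ^ 2
       = (2 * h) ^ (4 * m * (m + 1)) * (\<Prod>l = 1..m. fact l ^ 8) * ((e ^ Suc m * e ^ Suc m)\<^sup>2 * fact (Suc m) ^ 8)"
      by (simp only: Suc.IH power_mult_distrib[of "prod _ _"])
    also have "\<dots> = (2 * h) ^ (4 * m * (m + 1) + 8 * Suc m) * (\<Prod>l = 1..Suc m. fact l ^ 8)"
    proof -
      have "((2 * h) ^ (4 * Suc m))\<^sup>2 = (2 * h) ^ (8 * Suc m)"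
        unfolding power_mult[symmetric] by (rule arg_cong[of _ _ "power (2 * h)"]) simp
      moreover have "(\<Prod>l = 1..Suc m. fact l ^ 8) = (\<Prod>l = 1..m. fact l ^ 8) * (fact (Suc m) ^ 8 :: 'a)"
        by (rule prod.cl_ivl_Suc[THEN trans]) simp
      ultimately show ?thesis
        unfolding e by (simp only: power_add mult_ac)
    qed
    also have "4 * m * (m + 1) + 8 * Suc m = 4 * Suc m * (Suc m + 1)" by (simp add: algebra_simps)
    finally show ?case .
  qed
  then show ?thesis
    using det_swap_block_even[of "m + 1", where 'a = 'a]
    by (simp add: hankel_det_eq_prod del: prod.lessThan_Suc)
qed

end

section \<open>Specialization to Euler polynomials and Euler numbers\<close>

text \<open>The factor k with the index shift multiplies the generating function by t, giving 2t
  e^(xt) / (e^t + 1) = 2t / (e^((1-x)t) + e^(-xt)). At k = 0 the factor 0 cancels the truncated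
  index \<open>0 - 1 = 0\<close>.\<close>

lemma euler_poly_moments: "euler_moments (\<lambda>k. of_nat k * poly (euler_poly (k - 1)) x) (1 / 2 - x) (1 / 2)"
proof
  have "Abs_fps (\<lambda>k. of_nat k * poly (euler_poly (k - 1)) x / fact k)
     = fps_X * Abs_fps (\<lambda>k. poly (euler_poly k) x / fact k)"
    by (rule fps_ext) (auto simp: fps_X_mult_nth fact_reduce)
  moreover have "(fps_exp 1 + 1) * (2 * fps_exp x / (fps_exp 1 + 1)) = (2 * fps_exp x :: 'a fps)"
    by (simp add: fps_divide_unit inverse_mult_eq_1' mult.left_commute)
  moreover have "fps_exp (1 - x) + fps_exp (- x) = fps_exp (- x) * (fps_exp 1 + 1)"
    by (simp add: distrib_left flip: fps_exp_add_mult)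
  moreover have "fps_exp (- x) * fps_exp x = 1"
    by (simp flip: fps_exp_add_mult)
  ultimately show "(fps_exp (1 / 2 - x + 1 / 2) + fps_exp (1 / 2 - x - 1 / 2)) *
      Abs_fps (\<lambda>k. of_nat k * poly (euler_poly (k - 1)) x / fact k) = 2 * fps_X"
    by (simp add: poly_euler_poly_gen_fun)
qed

lemma euler_num_moments: "euler_moments (\<lambda>k. of_nat k * euler_num (k - 1)) 0 1"
proof
  let ?F = "fps_exp 1 + fps_exp (- 1) :: 'a fps"
  have "Abs_fps (\<lambda>k. of_nat k * euler_num (k - 1) / fact k) = fps_X * (2 / ?F)"
    by (rule fps_ext) (auto simp: fps_X_mult_nth fact_reduce euler_num_def)
  moreover have "?F * (2 / ?F) = 2"
    by (simp add: fps_divide_unit inverse_mult_eq_1' mult.left_commute)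
  ultimately show "(fps_exp (0 + 1) + fps_exp (0 - 1)) *
      Abs_fps (\<lambda>k. of_nat k * euler_num (k - 1) / fact k) = 2 * (fps_X :: 'a fps)"
    by (simp add: mult.left_commute)
qed

theorem corollary3p4:
  fixes m :: nat and x :: complex
  shows
    "(hankel_det (2 * m) (\<lambda>k. of_nat k * (euler_poly (k - 1) :: complex poly)) = 0 \<and>
      hankel_det (2 * m + 1) (\<lambda>k. of_nat k * (euler_poly (k - 1) :: complex poly))
        = (-1) ^ (m + 1) * (\<Prod>l = 1..m. fact l ^ 8)) \<and>
     (hankel_det (2 * m) (\<lambda>k. of_nat k * poly (euler_poly (k - 1)) x) = 0 \<and>
      hankel_det (2 * m + 1) (\<lambda>k. of_nat k * poly (euler_poly (k - 1)) x)
        = (-1) ^ (m + 1) * (\<Prod>l = 1..m. fact l ^ 8)) \<and>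
     (hankel_det (2 * m) (\<lambda>k. of_nat k * (euler_num (k - 1) :: complex)) = 0 \<and>
      hankel_det (2 * m + 1) (\<lambda>k. of_nat k * (euler_num (k - 1) :: complex))
        = (-1) ^ (m + 1) * 2 ^ (4 * m * (m + 1)) * (\<Prod>l = 1..m. fact l ^ 8))"
proof -
  \<comment> \<open>Since 2h = 1 here, the power of 2h disappears and the value does not depend on
    x.\<close>
  have poly_case: "hankel_det (2 * m) (\<lambda>k. of_nat k * poly (euler_poly (k - 1)) x) = 0"
    "hankel_det (2 * m + 1) (\<lambda>k. of_nat k * poly (euler_poly (k - 1)) x)
      = (-1) ^ (m + 1) * (\<Prod>l = 1..m. fact l ^ 8)" for x :: complex
    using euler_moments.hankel_det_even[OF euler_poly_moments[of x], of m]
      euler_moments.hankel_det_odd[OF euler_poly_moments[of x], of m] by simp_all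
  have poly_fact: "poly (fact l) x = fact l" for l and x :: complex
    by (metis of_nat_fact of_nat_poly poly_const_conv)
  \<comment> \<open>For the formal variable, both sides are compared at every complex point.\<close>
  have "hankel_det (2 * m) (\<lambda>k. of_nat k * (euler_poly (k - 1) :: complex poly)) = 0"
    by (intro poly_eq_poly_eq_iff[THEN iffD1] ext)
       (use poly_case(1) in \<open>simp add: poly_hankel_det\<close>)
  moreover have "hankel_det (2 * m + 1) (\<lambda>k. of_nat k * (euler_poly (k - 1) :: complex poly))
      = (-1) ^ (m + 1) * (\<Prod>l = 1..m. fact l ^ 8)"
    by (intro poly_eq_poly_eq_iff[THEN iffD1] ext)
       (use poly_case(2) in \<open>simp add: poly_hankel_det poly_prod poly_fact\<close>)
  moreover have "hankel_det (2 * m) (\<lambda>k. of_nat k * (euler_num (k - 1) :: complex)) = 0"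
    by (rule euler_moments.hankel_det_even[OF euler_num_moments])
  moreover have "hankel_det (2 * m + 1) (\<lambda>k. of_nat k * (euler_num (k - 1) :: complex))
      = (-1) ^ (m + 1) * 2 ^ (4 * m * (m + 1)) * (\<Prod>l = 1..m. fact l ^ 8)"
    using euler_moments.hankel_det_odd[OF euler_num_moments, of m] by simp
  ultimately show ?thesis using poly_case by blast
qed

end
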